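(* Let $x^3+px^2+qx+r$ (with $p,q,r\in\mathbb{R}$, $r\neq 0$) be a Ramanujan cubic polynomial (RCP) with roots $x_1,x_2,x_3$. Then: 1) For any $a\in\mathbb{R}$, $a\neq 0$, the polynomial $x^3+apx^2+a^2qx+a^3r$ is also an RCP, with roots $ax_1,ax_2,ax_3$. 2) The polynomial $x^3+qx^2+(pr)x+r^2$ is also an RCP, with roots $\frac{r}{x_1},\frac{r}{x_2},\frac{r}{x_3}$. 3) The numbers $\frac{r^{2/3}}{x_1},\frac{r^{2/3}}{x_2},\frac{r^{2/3}}{x_3}$ are a permutation of the numbers $r^{1/3}-x_1,\ r^{1/3}-x_2,\ r^{1/3}-x_3$. 4) $\frac{pq}{r}\leq \frac{9}{4}$.
   Context: For a real number $y$, $y^{1/3}$ denotes the real cube root of $y$, and $y^{2/3}=(y^{1/3})^2$. Definition. Let $p,q,r\in\mathbb{R}$ with $r\neq 0$. The cubic polynomial $x^3+px^2+qx+r$ is called a Ramanujan cubic polynomial (RCP) if all its roots are real and the condition $pr^{1/3}+3r^{2/3}+q=0$ is satisfied. The roots $x_1,x_2,x_3$ are listed with multiplicity (they are nonzero since $r\ne 0$), and "permutation" means equality of the two lists as multisets. *)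

theory Defs
  imports Complex_Main "HOL-Computational_Algebra.Polynomial"
begin

definition all_roots_real :: "real poly \<Rightarrow> bool" where
  "all_roots_real f \<longleftrightarrow> (\<forall>z::complex. poly (map_poly complex_of_real f) z = 0 \<longrightarrow> z \<in> \<real>)"

(* For odd n, root n is total on the reals and negative at negative arguments, so root 3 is the
   real cube root.  Coefficient lists start with the constant term: [:r, q, p, 1:] is
   x^3 + p x^2 + q x + r. *)
definition ramanujan_cubic :: "real poly \<Rightarrow> bool" where
  "ramanujan_cubic f \<longleftrightarrow>
     (\<exists>p q r. r \<noteq> 0 \<and> f = [:r, q, p, 1:] \<and> all_roots_real f \<and>
        p * root 3 r + 3 * (root 3 r)\<^sup>2 + q = 0)"

(* proots f is the multiset of roots with multiplicity in the base field; for a cubic with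
   all_roots_real it has size 3. *)
definition has_roots :: "real poly \<Rightarrow> real \<Rightarrow> real \<Rightarrow> real \<Rightarrow> bool" where
  "has_roots f x y z \<longleftrightarrow> proots f = {#x, y, z#}"

end

theory Submission
  imports Defs
begin

text \<open>Put s = root 3 r, so that r = s^3. Each claim becomes an identity between coefficients once
  a triple of real numbers is identified with the monic cubic that has these numbers as roots
  (lemma \<open>has_roots_iff_vieta\<close>): a cubic with three real roots is determined by its coefficients,
  and these are the elementary symmetric functions of the roots. In particular a monic cubic has
  at most one multiset of roots, so two triples with equal symmetric functions are permutations
  of each other.

  Scaling the roots by a multiplies s by a, and the left side of
  p * s + 3 * s^2 + q = 0 by a^2. Since the product of the roots is - r, replacing x_i by r / x_i
  means passing to the negated products of pairs; it replaces s by s^2 and multiplies the left side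
  by s^2. So both operations preserve the Ramanujan condition.

  For the third claim, the reciprocal substitution y = s^2 / x yields the cubic
  y^3 + (q / s) y^2 + p s y + s^3, whereas the reflection y = s - x yields
  y^3 - (3 s + p) y^2 + (3 s^2 + 2 p s + q) y - (2 s^3 + p s^2 + q s). The Ramanujan condition is
  exactly what makes these cubics coincide. (Equivalently: it makes the multiset of roots invariant under the
  Moebius map x \<mapsto> s^2 / (s - x) of order three.)

  The bound holds because the condition gives p q / r = - t (t + 3) with t = p / s, a
  quadratic in t whose maximum 9 / 4 is attained at t = - 3 / 2.\<close>

lemma proots_three_linear_factors:
  "proots ([:-x, 1:] * [:-y, 1:] * [:-z, 1:] :: real poly) = {#x, y, z#}"
  by (simp add: proots_mult del: mult_pCons_left mult_pCons_right)

text \<open>Splitting off the linear factor of a root removes one copy of that root from the multiset;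
  three such steps exhaust the cubic and leave a constant.\<close>

lemma proots_eq_add_msetE:
  fixes f :: "'a::idom poly"
  assumes "f \<noteq> 0" and "proots f = add_mset x A"
  obtains g where "f = [:-x, 1:] * g" and "g \<noteq> 0" and "proots g = A"
proof -
  have "x \<in># proots f"
    using assms(2) by simp
  then have "poly f x = 0"
    using assms(1) by simp
  then obtain g where g: "f = [:-x, 1:] * g"
    by (metis dvdE poly_eq_0_iff_dvd)
  then have "g \<noteq> 0"
    using assms(1) by auto
  moreover from this have "proots f = add_mset x (proots g)"
    unfolding g by (subst proots_mult) auto
  ultimately show thesis
    using that g assms(2) by simp
qed

lemma has_roots_iff_vieta:
  "has_roots [:r, q, p, 1:] x y z \<longleftrightarrow>
     p = - (x + y + z) \<and> q = x * y + y * z + z * x \<and> r = - (x * y * z)"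
    (is "?roots \<longleftrightarrow> ?vieta")
proof
  assume ?roots
  then have roots: "proots [:r, q, p, 1:] = {#x, y, z#}"
    by (simp add: has_roots_def)
  obtain g where f: "[:r, q, p, 1:] = [:-x, 1:] * g" and "g \<noteq> 0" "proots g = {#y, z#}"
    using proots_eq_add_msetE[OF _ roots] by auto
  then obtain h where g: "g = [:-y, 1:] * h" and "h \<noteq> 0" "proots h = {#z#}"
    using proots_eq_add_msetE[of g] by metis
  then obtain k where h: "h = [:-z, 1:] * k" and "k \<noteq> 0"
    using proots_eq_add_msetE[of h] by metis
  let ?l = "[:-x, 1:] * [:-y, 1:] * [:-z, 1:]"
  have fk: "[:r, q, p, 1:] = ?l * k"
    by (simp only: f g h mult.assoc)
  have "degree (?l * k) = 3 + degree k"
    using \<open>k \<noteq> 0\<close> by (subst degree_mult_eq) auto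
  then have "degree k = 0"
    using fk[symmetric] by simp
  then obtain c where "k = [:c:]"
    using degree_eq_zeroE by blast
  then show ?vieta
    using fk by (auto simp: algebra_simps)
next
  assume ?vieta
  then have "[:r, q, p, 1:] = [:-x, 1:] * [:-y, 1:] * [:-z, 1:]"
    by (simp add: algebra_simps)
  then show ?roots
    unfolding has_roots_def by (simp only: proots_three_linear_factors)
qed

text \<open>Three real roots use up the degree, so over the complex numbers the cubic splits into the
  same linear factors and has no further zeros.\<close>

lemma has_roots_imp_all_roots_real:
  assumes "has_roots [:r, q, p, 1:] x y z"
  shows "all_roots_real [:r, q, p, 1:]"
  unfolding all_roots_real_def
proof (intro allI impI)
  have p: "p = - (x + y + z)" and q: "q = x * y + y * z + z * x" and r: "r = - (x * y * z)"
    using assms by (simp_all add: has_roots_iff_vieta)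
  fix w :: complex
  assume "poly (map_poly complex_of_real [:r, q, p, 1:]) w = 0"
  moreover have "poly (map_poly complex_of_real [:r, q, p, 1:]) w =
      (w - of_real x) * (w - of_real y) * (w - of_real z)"
    unfolding p q r by (simp add: map_poly_pCons algebra_simps)
  ultimately show "w \<in> \<real>"
    by auto
qed

lemma ramanujan_cubic_iff:
  "ramanujan_cubic [:r, q, p, 1:] \<longleftrightarrow>
     r \<noteq> 0 \<and> all_roots_real [:r, q, p, 1:] \<and> p * root 3 r + 3 * (root 3 r)\<^sup>2 + q = 0"
  by (auto simp: ramanujan_cubic_def)

lemma ramanujan_cubicI:
  assumes "has_roots [:r, q, p, 1:] x y z" and "r \<noteq> 0"
    and "p * root 3 r + 3 * (root 3 r)\<^sup>2 + q = 0"
  shows "ramanujan_cubic [:r, q, p, 1:]"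
  using assms has_roots_imp_all_roots_real by (simp add: ramanujan_cubic_iff)

theorem theorem3:
  fixes p q r x1 x2 x3 :: real
  assumes "r \<noteq> 0"
    and "ramanujan_cubic [:r, q, p, 1:]"
    and "has_roots [:r, q, p, 1:] x1 x2 x3"
  shows "(\<forall>a::real. a \<noteq> 0 \<longrightarrow>
            ramanujan_cubic [:a^3 * r, a^2 * q, a * p, 1:] \<and>
            has_roots [:a^3 * r, a^2 * q, a * p, 1:] (a * x1) (a * x2) (a * x3)) \<and>
         (ramanujan_cubic [:r^2, p * r, q, 1:] \<and>
            has_roots [:r^2, p * r, q, 1:] (r / x1) (r / x2) (r / x3)) \<and>
         {# (root 3 r)^2 / x1, (root 3 r)^2 / x2, (root 3 r)^2 / x3 #} =
           {# root 3 r - x1, root 3 r - x2, root 3 r - x3 #} \<and>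
         p * q / r \<le> 9 / 4"
proof -
  define s where "s = root 3 r"
  have r: "r = s ^ 3"
    by (simp add: s_def odd_real_root_pow)
  have "s \<noteq> 0"
    using \<open>r \<noteq> 0\<close> r by auto
  have ram: "p * s + 3 * s\<^sup>2 + q = 0"
    using assms(2) by (simp add: ramanujan_cubic_iff s_def)
  have p: "p = - (x1 + x2 + x3)" and q: "q = x1 * x2 + x2 * x3 + x3 * x1"
    and r': "r = - (x1 * x2 * x3)"
    using assms(3) by (simp_all add: has_roots_iff_vieta)
  have nz: "x1 \<noteq> 0" "x2 \<noteq> 0" "x3 \<noteq> 0"
    using \<open>r \<noteq> 0\<close> r' by auto

  have scaling: "ramanujan_cubic [:a^3 * r, a^2 * q, a * p, 1:] \<and>
      has_roots [:a^3 * r, a^2 * q, a * p, 1:] (a * x1) (a * x2) (a * x3)"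
    if "a \<noteq> 0" for a
  proof -
    have roots: "has_roots [:a^3 * r, a^2 * q, a * p, 1:] (a * x1) (a * x2) (a * x3)"
      by (simp add: has_roots_iff_vieta p q r' algebra_simps power2_eq_square power3_eq_cube)
    have "root 3 (a^3 * r) = a * s"
      by (simp add: s_def real_root_mult odd_real_root_power_cancel)
    moreover have "a * p * (a * s) + 3 * (a * s)\<^sup>2 + a\<^sup>2 * q = a\<^sup>2 * (p * s + 3 * s\<^sup>2 + q)"
      by algebra
    ultimately have "ramanujan_cubic [:a^3 * r, a^2 * q, a * p, 1:]"
      using ram \<open>r \<noteq> 0\<close> \<open>a \<noteq> 0\<close> by (intro ramanujan_cubicI[OF roots]) auto
    with roots show ?thesis
      by simp
  qed

  have inverse: "ramanujan_cubic [:r^2, p * r, q, 1:] \<and>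
      has_roots [:r^2, p * r, q, 1:] (r / x1) (r / x2) (r / x3)"
  proof -
    have "r / x1 = - (x2 * x3)" "r / x2 = - (x3 * x1)" "r / x3 = - (x1 * x2)"
      using nz by (simp_all add: r')
    then have roots: "has_roots [:r^2, p * r, q, 1:] (r / x1) (r / x2) (r / x3)"
      by (simp add: has_roots_iff_vieta p q r' algebra_simps power2_eq_square)
    have "root 3 (r\<^sup>2) = s\<^sup>2"
      by (simp add: s_def real_root_power)
    moreover have "q * s\<^sup>2 + 3 * (s\<^sup>2)\<^sup>2 + p * r = s\<^sup>2 * (p * s + 3 * s\<^sup>2 + q)"
      unfolding r by algebra
    ultimately have "ramanujan_cubic [:r^2, p * r, q, 1:]"
      using ram \<open>r \<noteq> 0\<close> by (intro ramanujan_cubicI[OF roots]) auto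
    with roots show ?thesis
      by simp
  qed

  have permutation: "{# s^2 / x1, s^2 / x2, s^2 / x3 #} = {# s - x1, s - x2, s - x3 #}"
  proof -
    \<comment> \<open>The common cubic of both triples; the coefficient q / s is written as - (p + 3 * s).\<close>
    let ?g = "[:s ^ 3, p * s, - (p + 3 * s), 1:]"
    have q': "q = - s * (p + 3 * s)"
      using ram by algebra
    have "has_roots ?g (s - x1) (s - x2) (s - x3)"
      unfolding has_roots_iff_vieta
    proof (intro conjI)
      show "- (p + 3 * s) = - ((s - x1) + (s - x2) + (s - x3))"
        using p by algebra
      show "p * s = (s - x1) * (s - x2) + (s - x2) * (s - x3) + (s - x3) * (s - x1)"
        using p q q' by algebra
      show "s ^ 3 = - ((s - x1) * (s - x2) * (s - x3))"
        using p q q' r r' by algebra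
    qed
    moreover have "has_roots ?g (s^2 / x1) (s^2 / x2) (s^2 / x3)"
    proof -
      have y: "s^2 / x1 = - (x2 * x3) / s" "s^2 / x2 = - (x3 * x1) / s" "s^2 / x3 = - (x1 * x2) / s"
        using r r' nz \<open>s \<noteq> 0\<close> by (simp_all add: field_simps power2_eq_square power3_eq_cube)
      show ?thesis
        unfolding has_roots_iff_vieta y
      proof (intro conjI)
        show "- (p + 3 * s) = - (- (x2 * x3) / s + - (x3 * x1) / s + - (x1 * x2) / s)"
          using q q' \<open>s \<noteq> 0\<close> by (simp add: field_simps)
        have "p * s * s\<^sup>2 = x1 * x2 * x3 * (x1 + x2 + x3)"
          using p r r' by algebra
        then show "p * s = - (x2 * x3) / s * (- (x3 * x1) / s) + - (x3 * x1) / s * (- (x1 * x2) / s)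
            + - (x1 * x2) / s * (- (x2 * x3) / s)"
          using \<open>s \<noteq> 0\<close> by (simp add: field_simps power2_eq_square)
        have "s ^ 3 * s ^ 3 = (x1 * x2 * x3)\<^sup>2"
          using r r' by algebra
        then show "s ^ 3 = - (- (x2 * x3) / s * (- (x3 * x1) / s) * (- (x1 * x2) / s))"
          using \<open>s \<noteq> 0\<close> by (simp add: field_simps power2_eq_square power3_eq_cube)
      qed
    qed
    ultimately show ?thesis
      by (simp add: has_roots_def)
  qed

  have bound: "p * q / r \<le> 9 / 4"
  proof -
    define t where "t = p / s"
    have pt: "p = t * s"
      using \<open>s \<noteq> 0\<close> by (simp add: t_def)
    have "p * q = - t * (t + 3) * r"
      using ram unfolding pt r by algebra
    then have "p * q / r = - t * (t + 3)"
      using \<open>r \<noteq> 0\<close> by simp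
    also have "\<dots> = 9 / 4 - (t + 3 / 2)\<^sup>2"
      by (simp add: power2_eq_square algebra_simps)
    finally have "p * q / r = 9 / 4 - (t + 3 / 2)\<^sup>2" .
    then show ?thesis
      by simp
  qed

  show ?thesis
    using scaling inverse permutation bound by (simp add: s_def)
qed

end
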